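(* Let $f\in\mathcal{S}$, and let $\Gamma_1$ and $\Gamma_2$ be the first two logarithmic coefficients of the inverse function $f^{-1}$. Then $$-\frac{\sqrt{2}}{2}\le |\Gamma_2|-|\Gamma_1|\le \frac{1}{2}.$$ The upper bound is sharp.
   Context: Let $\mathbb{D}=\{z\in\mathbb{C}:|z|<1\}$. $\mathcal{A}$ is the class of functions $f$ analytic in $\mathbb{D}$ of the form $f(z)=z+a_2z^2+a_3z^3+\cdots$, and $\mathcal{S}$ is the subclass of $\mathcal{A}$ of functions univalent (injective) in $\mathbb{D}$. By Koebe's $1/4$ theorem, each $f\in\mathcal{S}$ has an inverse $f^{-1}$ defined at least on the disk $|w|<1/4$, with expansion $f^{-1}(w)=w+A_2w^2+A_3w^3+\cdots$. The logarithmic coefficients $\Gamma_n$ of $f^{-1}$ are defined by $\log\frac{f^{-1}(w)}{w}=2\sum_{n=1}^\infty\Gamma_n w^n$ for $w$ near $0$ (branch of the logarithm vanishing at $w=0$). A bound is called sharp if equality holds for at least one function $f$ in the class considered. *)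

theory Defs
  imports "HOL-Complex_Analysis.Complex_Analysis"
begin

definition class_A :: "(complex \<Rightarrow> complex) set" where
  "class_A = {f. f holomorphic_on ball 0 1 \<and> f 0 = 0 \<and> deriv f 0 = 1}"

definition class_S :: "(complex \<Rightarrow> complex) set" where
  "class_S = {f \<in> class_A. inj_on f (ball 0 1)}"

definition disk_inv :: "(complex \<Rightarrow> complex) \<Rightarrow> complex \<Rightarrow> complex" where
  "disk_inv f = inv_into (ball 0 1) f"

text \<open>
  The quotient tends to 1 at the origin, where it has a removable singularity, so near the
  origin the principal branch \<open>Ln\<close> is the branch of the logarithm that vanishes there.
\<close>

definition log_inv :: "(complex \<Rightarrow> complex) \<Rightarrow> complex \<Rightarrow> complex" where
  "log_inv f w = Ln (if w = 0 then 1 else disk_inv f w / w)"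

definition inv_log_coeff :: "(complex \<Rightarrow> complex) \<Rightarrow> nat \<Rightarrow> complex" where
  "inv_log_coeff f n = fps_nth (fps_expansion (log_inv f) 0) n / 2"

lemma log_inv_analytic:
  assumes "f \<in> class_S"
  shows "log_inv f analytic_on {0}"
proof -
  let ?B = "ball 0 1 :: complex set"
  have hf: "f holomorphic_on ?B" and f0: "f 0 = 0" and d: "deriv f 0 = 1"
    and inj: "inj_on f ?B"
    using assms by (auto simp: class_S_def class_A_def)
  obtain g where g: "g holomorphic_on (f ` ?B)"
    and gd: "\<And>z. z \<in> ?B \<Longrightarrow> deriv f z * deriv g (f z) = 1"
    and gf: "\<And>z. z \<in> ?B \<Longrightarrow> g (f z) = z"
    using holomorphic_has_inverse[OF hf open_ball inj] by metis
  have op: "open (f ` ?B)" using open_mapping_thm3[OF hf open_ball inj] .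
  have in0: "0 \<in> f ` ?B" using f0 by (auto intro!: image_eqI[of _ _ 0])
  have eq: "disk_inv f w = g w" if "w \<in> f ` ?B" for w
    using that gf inj by (auto simp: disk_inv_def)
  have g0: "g 0 = 0" using gf[of 0] f0 by simp
  have dg: "deriv g 0 = 1" using gd[of 0] f0 d by simp
  let ?q = "\<lambda>w. if w = 0 then deriv g 0 else (g w - g 0) / (w - 0)"
  have hq: "?q holomorphic_on (f ` ?B)"
    using pole_lemma[OF g, of 0] in0 op by (simp add: interior_open)
  have "?q analytic_on {0}"
    using hq op in0 analytic_at by blast
  then have "(\<lambda>w. Ln (?q w)) analytic_on {0}"
    by (intro analytic_intros) (auto simp: dg)
  moreover have "\<forall>\<^sub>F w in nhds 0. Ln (?q w) = log_inv f w"
    using eventually_nhds_in_open[OF op in0]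
    by eventually_elim (auto simp: log_inv_def eq g0 dg)
  ultimately show ?thesis
    using analytic_at_cong[of "\<lambda>w. Ln (?q w)" "log_inv f" 0 0] by simp
qed

lemma inv_log_coeff_sums:
  assumes "f \<in> class_S"
  shows "\<forall>\<^sub>F w in nhds 0. (\<lambda>n. 2 * (inv_log_coeff f (Suc n) * w ^ Suc n)) sums log_inv f w"
proof -
  have "log_inv f has_fps_expansion fps_expansion (log_inv f) 0"
    using analytic_at_imp_has_fps_expansion_0[OF log_inv_analytic[OF assms]] .
  then have conv: "0 < fps_conv_radius (fps_expansion (log_inv f) 0)"
    and ev: "\<forall>\<^sub>F w in nhds 0. eval_fps (fps_expansion (log_inv f) 0) w = log_inv f w"
    by (auto simp: has_fps_expansion_def)
  have "\<forall>\<^sub>F w in nhds 0. w \<in> eball 0 (fps_conv_radius (fps_expansion (log_inv f) 0))"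
    using conv by (intro eventually_nhds_in_open) (auto simp: zero_ereal_def)
  with ev show ?thesis
  proof eventually_elim
    case (elim w)
    let ?c = "\<lambda>n. fps_nth (fps_expansion (log_inv f) 0) n * w ^ n"
    have "?c sums log_inv f w"
      using sums_eval_fps[of w "fps_expansion (log_inv f) 0"] elim by (simp add: in_eball_iff)
    moreover have "?c 0 = 0"
      by (simp add: fps_expansion_def log_inv_def)
    ultimately have "(\<lambda>n. ?c (Suc n)) sums log_inv f w"
      using sums_Suc_iff[of ?c "log_inv f w"] by simp
    then show ?case
      by (simp add: inv_log_coeff_def)
  qed
qed

end

theory Submission
  imports Defs
begin

text \<open>
  Write \<open>f z = z * p z\<close> with \<open>p 0 = 1\<close>; univalence makes \<open>p\<close> zero-free, so \<open>1 / p\<close> has a holomorphic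
  square root \<open>s z = 1 + u z + v z\<^sup>2 + \<dots>\<close> in the disc. At \<open>w = f z\<close> the quotient of the inverse
  function by \<open>w\<close> is \<open>1 / p z = (s z)\<^sup>2\<close>, and comparing coefficients gives \<open>\<Gamma>\<^sub>1 = u\<close> and
  \<open>\<Gamma>\<^sub>2 = (3 u\<^sup>2 + 2 v) / 2\<close>.

  The area theorem (\<open>area_theorem\<close>) controls \<open>u\<close> and \<open>v\<close> in two ways. Applied to
  \<open>1 / f z = (s z)\<^sup>2 / z\<close> it yields \<open>|u\<^sup>2 + 2 v| \<le> 1\<close>. Applied to \<open>s (z\<^sup>2) / z\<close>, the reciprocal of the
  odd univalent function \<open>\<surd>f(z\<^sup>2)\<close>, it yields \<open>|u|\<^sup>2 + 3 |v|\<^sup>2 \<le> 1\<close>.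
  Upper bound: \<open>|3 u\<^sup>2 + 2 v| \<le> 1 + 2 |u|\<^sup>2 \<le> 1 + 2 |u|\<close> because \<open>|u| \<le> 1\<close>.
  Lower bound: nothing is to be shown if \<open>|u| \<le> \<surd>2 / 2\<close>. Otherwise \<open>|v| < 1 / 2\<close>, and
  \<open>|3 u\<^sup>2 + 2 v| \<ge> 3 |u|\<^sup>2 - 2 |v|\<close> suffices.
  Sharpness: \<open>f z = z / (1 - z\<^sup>2)\<close> has \<open>u = 0\<close> and \<open>v = - 1 / 2\<close>.

  The area theorem itself says that \<open>g z = 1 / z + b\<^sub>0 + b\<^sub>1 z + \<dots>\<close>, univalent in the punctured disc,
  has \<open>\<Sum> m |b\<^sub>m|\<^sup>2 \<le> 1\<close>. The proof compares two estimates for the area of the image of the annulus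
  \<open>r < |z| < \<rho>\<close>. By change of variables this area is the integral of \<open>|g'|\<^sup>2\<close>, which Bessel's
  inequality bounds from below (\<open>circle_bessel\<close>). On the other hand the image misses what \<open>g\<close> does to
  the disc of radius \<open>r\<close>, so it lies inside the curve \<open>g (|z| = r)\<close>, which is nearly an ellipse
  (\<open>image_off_small_disc_in_ellipse\<close>). The leading terms \<open>\<pi> / r\<^sup>2\<close> cancel, and \<open>r \<rightarrow> 0\<close> followed by
  \<open>\<rho> \<rightarrow> 1\<close> gives the claim. An ellipse is really needed: enclosing the image in a round disc would cost
  an error in area that stays bounded but does not tend to 0.
\<close>

section \<open>Area in the complex plane\<close>

unbundle no fps_syntax

text \<open>
  Change of variables is phrased through determinants of matrices, so areas of sets of complex numbers
  are measured after transport along this isometry.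
\<close>

definition plane_vec :: "complex \<Rightarrow> real ^ 2" where
  "plane_vec z = vector [Re z, Im z]"

definition vec_plane :: "real ^ 2 \<Rightarrow> complex" where
  "vec_plane v = Complex (v $ 1) (v $ 2)"

lemma vec_plane_vec [simp]: "vec_plane (plane_vec z) = z"
  by (simp add: vec_plane_def plane_vec_def)

lemma plane_vec_plane [simp]: "plane_vec (vec_plane v) = v"
  by (simp add: vec_plane_def plane_vec_def vec_eq_iff forall_2)

lemma linear_plane_vec: "linear plane_vec"
  by (rule linearI) (simp_all add: plane_vec_def vec_eq_iff forall_2)

lemma linear_vec_plane: "linear vec_plane"
  by (rule linearI) (simp_all add: vec_plane_def complex_eq_iff)

lemma norm_plane_vec [simp]: "norm (plane_vec z) = cmod z"
  by (simp add: plane_vec_def norm_vec_def L2_set_def sum_2 cmod_def)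

lemma det_matrix_plane:
  assumes "linear L"
  shows "det (matrix (\<lambda>v. plane_vec (L (vec_plane v)))) = Re (L 1) * Im (L \<i>) - Re (L \<i>) * Im (L 1)"
proof -
  have "vec_plane (axis 1 1) = 1" "vec_plane (axis 2 1) = \<i>"
    by (simp_all add: vec_plane_def axis_def complex_eq_iff)
  then show ?thesis
    by (simp add: det_2 matrix_def plane_vec_def)
qed

text \<open>
  The map \<open>v \<mapsto> v + c * cnj v\<close> is real linear with determinant \<open>1 - |c|\<^sup>2\<close>; for \<open>|c| < 1\<close> the images of
  discs are ellipses.
\<close>

lemma measure_ellipse:
  assumes "R \<ge> 0"
  shows "plane_vec ` (\<lambda>v. v + c * cnj v) ` cball 0 R \<in> lmeasurable"
    and "measure lebesgue (plane_vec ` (\<lambda>v. v + c * cnj v) ` cball 0 R) = \<bar>1 - (cmod c)\<^sup>2\<bar> * (pi * R\<^sup>2)"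
proof -
  let ?L = "\<lambda>v. v + c * cnj v"
  let ?M = "\<lambda>v. plane_vec (?L (vec_plane v))"
  have lin: "linear ?L"
    by (rule linearI) (simp_all add: algebra_simps scaleR_conv_of_real)
  have linM: "linear ?M"
    using linear_compose[OF linear_compose[OF linear_vec_plane lin] linear_plane_vec] by (simp add: o_def)
  have ball: "vec_plane ` cball 0 R = cball 0 R"
  proof (intro set_eqI iffI)
    fix z :: complex assume "z \<in> cball 0 R"
    then show "z \<in> vec_plane ` cball 0 R"
      by (intro image_eqI[of _ _ "plane_vec z"]) auto
  next
    fix z :: complex assume "z \<in> vec_plane ` cball 0 R"
    then obtain v where "z = vec_plane v" "norm v \<le> R" by auto
    then show "z \<in> cball 0 R"
      using norm_plane_vec[of z] by simp
  qed
  have im: "plane_vec ` ?L ` cball 0 R = ?M ` cball 0 R"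
    by (simp add: image_image flip: ball)
  have "measure lebesgue (?M ` cball 0 R) = \<bar>det (matrix ?M)\<bar> * measure lebesgue (cball 0 R :: (real^2) set)"
    using measure_linear_image[OF linM, of "cball 0 R"] by simp
  moreover have "det (matrix ?M) = 1 - (cmod c)\<^sup>2"
    unfolding det_matrix_plane[OF lin] unfolding cmod_power2 by (simp add: algebra_simps power2_eq_square)
  moreover have "measure lebesgue (cball 0 R :: (real^2) set) = pi * R\<^sup>2"
    using content_cball[of R "0::real^2"] assms by (simp add: unit_ball_vol_2)
  ultimately show "measure lebesgue (plane_vec ` ?L ` cball 0 R) = \<bar>1 - (cmod c)\<^sup>2\<bar> * (pi * R\<^sup>2)"
    by (simp add: im)
  show "plane_vec ` ?L ` cball 0 R \<in> lmeasurable"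
    unfolding im using linM by (intro lmeasurable_compact compact_continuous_image linear_continuous_on) 
      (auto simp: linear_linear)
qed

text \<open>
  This is Fubini for a continuous function on a rectangle in \<open>real \<times> real\<close>, since regrouping coordinates
  preserves the content of boxes.
\<close>

lemma integral_plane_box:
  fixes u :: "complex \<Rightarrow> real"
  assumes cont: "continuous_on (cbox (Complex a c) (Complex b d)) u"
  shows "((\<lambda>v. u (vec_plane v)) has_integral
            integral {a..b} (\<lambda>s. integral {c..d} (\<lambda>t. u (Complex s t))))
           (cbox (plane_vec (Complex a c)) (plane_vec (Complex b d)))"
proof -
  let ?f = "\<lambda>(s, t). u (Complex s t)"
  let ?g = "\<lambda>v::real^2. (v $ 1, v $ 2)"
  let ?h = "\<lambda>(s, t). vector [s, t] :: real ^ 2"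
  have cf: "continuous_on (cbox (a, c) (b, d)) ?f"
    unfolding case_prod_beta
    by (rule continuous_on_compose2[OF cont])
      (auto intro!: continuous_intros simp: in_cbox_complex_iff Complex_eq)
  have I: "(?f has_integral integral {a..b} (\<lambda>s. integral {c..d} (\<lambda>t. u (Complex s t)))) (cbox (a, c) (b, d))"
    using integral_prod_continuous[OF cf] integrable_continuous[OF cf]
    by (simp add: has_integral_iff)
  have gim: "?g ` cbox u v = cbox (u $ 1, u $ 2) (v $ 1, v $ 2)" for u v :: "real^2"
  proof -
    have "x \<in> ?g ` cbox u v" if "x \<in> cbox (u $ 1, u $ 2) (v $ 1, v $ 2)" for x
      using that by (intro image_eqI[of _ _ "vector [fst x, snd x]"]) (auto simp: mem_box_cart forall_2 cbox_Pair_eq)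
    then show ?thesis
      by (auto simp: mem_box_cart forall_2 cbox_Pair_eq)
  qed
  have him: "?h ` cbox u v = cbox (vector [fst u, snd u]) (vector [fst v, snd v])" for u v
  proof -
    have "x \<in> ?h ` cbox u v" if "x \<in> cbox (vector [fst u, snd u]) (vector [fst v, snd v])" for x
      using that by (intro image_eqI[of _ _ "(x $ 1, x $ 2)"]) 
        (cases u, cases v, auto simp: mem_box_cart forall_2 vec_eq_iff cbox_Pair_eq)+
    then show ?thesis
      by (cases u, cases v) (auto simp: mem_box_cart forall_2 cbox_Pair_eq)
  qed
  have "((\<lambda>x. ?f (?g x)) has_integral (1 / 1) *\<^sub>R integral {a..b} (\<lambda>s. integral {c..d} (\<lambda>t. u (Complex s t))))
           (?h ` cbox (a, c) (b, d))"
  proof (rule has_integral_twiddle[where g = ?g and h = ?h and r = 1, OF _ _ _ _ _ _ _ I])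
    show "\<exists>w z. ?g ` cbox u v = cbox w z" for u v using gim by blast
    show "\<exists>w z. ?h ` cbox u v = cbox w z" for u v using him by blast
    show "measure lborel (?g ` cbox u v) = 1 * measure lborel (cbox u v)" for u v
    proof -
      have "(\<exists>i. v $ i < u $ i) \<longleftrightarrow> v $ 1 < u $ 1 \<or> v $ 2 < u $ 2"
        using forall_2[of "\<lambda>i. \<not> v $ i < u $ i"] by blast
      then show ?thesis
        unfolding gim content_Pair
        by (simp add: content_cbox_if_cart content_real_if UNIV_2 interval_eq_empty_cart)
    qed
    show "?h (?g x) = x" for x
      by (simp add: vec_eq_iff forall_2)
    show "?g (?h x) = x" for x
      by (cases x) simp
    show "continuous (at x) ?g" for x
      by (intro continuous_intros)
  qed auto
  then show ?thesis
    by (simp add: him vec_plane_def plane_vec_def)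
qed

text \<open>
  By the Cauchy-Riemann equations the Jacobian determinant of a holomorphic function is the squared
  modulus of its derivative. Injectivity is only asked for on the open rectangle, so that \<open>exp\<close> on a
  strip of height \<open>2 * pi\<close> is covered; its boundary has area 0.
\<close>

lemma measure_holomorphic_image_box:
  assumes hol: "G holomorphic_on A" and "open A" and sub: "cbox (Complex a c) (Complex b d) \<subseteq> A"
    and inj: "inj_on G (box (Complex a c) (Complex b d))"
  shows "plane_vec ` G ` box (Complex a c) (Complex b d) \<in> lmeasurable"
    and "measure lebesgue (plane_vec ` G ` box (Complex a c) (Complex b d)) =
           integral {a..b} (\<lambda>s. integral {c..d} (\<lambda>t. (cmod (deriv G (Complex s t)))\<^sup>2))"
    and "(\<lambda>s. integral {c..d} (\<lambda>t. (cmod (deriv G (Complex s t)))\<^sup>2)) integrable_on {a..b}"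
proof -
  let ?B = "box (Complex a c) (Complex b d)"
  let ?V = "box (plane_vec (Complex a c)) (plane_vec (Complex b d))"
  let ?F = "\<lambda>v. plane_vec (G (vec_plane v))"
  let ?F' = "\<lambda>v w. plane_vec (deriv G (vec_plane v) * vec_plane w)"
  let ?m = "integral {a..b} (\<lambda>s. integral {c..d} (\<lambda>t. (cmod (deriv G (Complex s t)))\<^sup>2))"
  have VB: "vec_plane v \<in> ?B \<longleftrightarrow> v \<in> ?V" for v
    by (auto simp: in_box_complex_iff vec_plane_def mem_box_cart plane_vec_def forall_2)
  have im: "plane_vec ` G ` ?B = ?F ` ?V"
  proof -
    have "z \<in> vec_plane ` ?V" if "z \<in> ?B" for z
      using that by (intro image_eqI[of _ _ "plane_vec z"]) (auto simp flip: VB)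
    then have "?B = vec_plane ` ?V"
      using VB by blast
    then show ?thesis by (simp add: image_image)
  qed
  have bl: "bounded_linear plane_vec" "bounded_linear vec_plane"
    using linear_plane_vec linear_vec_plane linear_linear by blast+
  have der: "(?F has_derivative ?F' v) (at v within ?V)" if "v \<in> ?V" for v
  proof -
    have "vec_plane v \<in> A"
      using VB[of v] that sub box_subset_cbox by blast
    then have "(G has_derivative (*) (deriv G (vec_plane v))) (at (vec_plane v))"
      using holomorphic_derivI[OF hol \<open>open A\<close>] by (simp add: has_field_derivative_def)
    then have "(G \<circ> vec_plane has_derivative (*) (deriv G (vec_plane v)) \<circ> vec_plane) (at v)"
      by (rule diff_chain_at[OF bounded_linear_imp_has_derivative[OF bl(2)]])
    then have "(plane_vec \<circ> (G \<circ> vec_plane) has_derivative plane_vec \<circ> ((*) (deriv G (vec_plane v)) \<circ> vec_plane)) (at v)"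
      by (rule diff_chain_at[OF _ bounded_linear_imp_has_derivative[OF bl(1)]])
    then show ?thesis
      by (auto simp: o_def intro: has_derivative_at_withinI)
  qed
  have injF: "inj_on ?F ?V"
  proof (rule inj_onI)
    fix v w assume "v \<in> ?V" "w \<in> ?V" "?F v = ?F w"
    then have "vec_plane v = vec_plane w"
      using inj VB by (metis inj_onD vec_plane_vec)
    then show "v = w"
      by (metis plane_vec_plane)
  qed
  have det: "\<bar>det (matrix (?F' v))\<bar> = (cmod (deriv G (vec_plane v)))\<^sup>2" for v
    using det_matrix_plane[of "(*) (deriv G (vec_plane v))"]
    unfolding cmod_power2 by (simp add: linear_times power2_eq_square)
  have cont: "continuous_on (cbox (Complex a c) (Complex b d)) (\<lambda>z. (cmod (deriv G z))\<^sup>2)"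
    by (intro continuous_intros holomorphic_on_imp_continuous_on holomorphic_on_subset[OF _ sub] holomorphic_deriv hol \<open>open A\<close>)
  have "continuous_on (cbox (a, c) (b, d)) (\<lambda>x. (cmod (deriv G (Complex (fst x) (snd x))))\<^sup>2)"
    by (rule continuous_on_compose2[OF cont])
      (auto intro!: continuous_intros simp: in_cbox_complex_iff Complex_eq)
  from integral_integrable_2dim[OF this]
  show "(\<lambda>s. integral {c..d} (\<lambda>t. (cmod (deriv G (Complex s t)))\<^sup>2)) integrable_on {a..b}"
    by simp
  from integral_plane_box[OF cont] have "((\<lambda>v. \<bar>det (matrix (?F' v))\<bar>) has_integral ?m) ?V"
    by (simp add: det has_integral_open_interval)
  with has_measure_differentiable_image[OF _ der injF, of ?m]
  show "plane_vec ` G ` ?B \<in> lmeasurable" "measure lebesgue (plane_vec ` G ` ?B) = ?m"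
    by (auto simp: im)
qed

section \<open>Bessel's inequality on circles\<close>

lemma circle_mean_value:
  assumes hol: "H holomorphic_on ball 0 1" and r: "0 < r" "r < 1"
  shows "((\<lambda>t. H (of_real r * cis t)) has_integral of_real (2 * pi) * H 0) {0..2 * pi}"
proof -
  have "H holomorphic_on cball 0 r"
    using r by (intro holomorphic_on_subset[OF hol]) auto
  then have "((\<lambda>u. H u / (u - 0)) has_contour_integral 2 * of_real pi * \<i> * H 0) (circlepath 0 r)"
    using r by (intro Cauchy_integral_circlepath_simple) auto
  then have "((\<lambda>t. H (0 + r * cis t) / (0 + r * cis t - 0) * r * \<i> * cis t) has_integral
               2 * of_real pi * \<i> * H 0) {0..2 * pi}"
    unfolding circlepath_def by (subst (asm) has_contour_integral_part_circlepath_iff) auto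
  then have "((\<lambda>t. \<i> * H (of_real r * cis t)) has_integral \<i> * (of_real (2 * pi) * H 0)) {0..2 * pi}"
    by (rule has_integral_eq_rhs[OF has_integral_eq[rotated]]) (use r in auto)
  from has_integral_mult_right[OF this, of "-\<i>"] show ?thesis
    by (simp flip: mult.assoc)
qed

lemma continuous_on_circle:
  assumes "H holomorphic_on ball 0 1" "0 < r" "r < 1"
  shows "continuous_on A (\<lambda>t. H (of_real r * cis t))"
proof (rule continuous_on_compose2[OF holomorphic_on_imp_continuous_on[OF assms(1)]])
  show "continuous_on A (\<lambda>t. of_real r * cis t)"
    by (intro continuous_intros)
  show "(\<lambda>t. of_real r * cis t) ` A \<subseteq> ball 0 1"
    using assms by (auto simp: norm_mult)
qed

lemma difference_quotient_holomorphic: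
  assumes "f holomorphic_on ball 0 1"
  shows "(\<lambda>z. if z = 0 then deriv f 0 else (f z - f 0) / z) holomorphic_on ball 0 1"
  using pole_lemma_open[OF assms open_ball, of 0] by (simp only: diff_zero)

text \<open>
  Induction on the number of coefficients, splitting off one at a time: in \<open>H z = H 0 + z * K z\<close> the
  two summands are orthogonal on the circle, since by the mean value property \<open>z * K z\<close> has mean 0.
\<close>

lemma circle_bessel:
  assumes "H holomorphic_on ball 0 1" "H has_fps_expansion F" and r: "0 < r" "r < 1"
  shows "2 * pi * (\<Sum>n<N. (cmod (fps_nth F n))\<^sup>2 * r ^ (2 * n))
           \<le> integral {0..2 * pi} (\<lambda>t. (cmod (H (of_real r * cis t)))\<^sup>2)"
  using assms(1,2)
proof (induction N arbitrary: H F)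
  case 0
  then show ?case
    using r by (auto intro!: integral_nonneg integrable_continuous_real continuous_intros continuous_on_circle)
next
  case (Suc N)
  let ?c = "fps_nth F 0"
  define K where "K = (\<lambda>z. if z = 0 then fps_nth F 1 else (H z - H 0) / z)"
  have H0: "H 0 = ?c"
    using fps_nth_fps_expansion[OF Suc.prems(2), of 0] by simp
  have "deriv H 0 = fps_nth F 1"
    using fps_nth_fps_expansion[OF Suc.prems(2), of 1] by simp
  then have holK: "K holomorphic_on ball 0 1"
    using difference_quotient_holomorphic[OF Suc.prems(1)] by (simp only: K_def)
  have K: "H z = ?c + z * K z" for z
    by (simp add: K_def H0)
  have "K has_fps_expansion fps_expansion K 0"
    by (rule has_fps_expansion_fps_expansion[of "ball 0 1"]) (use holK in auto)
  then have "(\<lambda>z. ?c + z * K z) has_fps_expansion fps_const ?c + fps_X * fps_expansion K 0"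
    by (intro fps_expansion_intros)
  then have F: "F = fps_const ?c + fps_X * fps_expansion K 0"
    using Suc.prems(2) fps_expansion_unique_complex[of H] by (simp only: K[symmetric])
  have "fps_nth F (Suc n) = fps_nth (fps_expansion K 0) n" for n
    by (subst F) simp
  then have "fps_shift 1 F = fps_expansion K 0"
    by (intro fps_ext) simp
  then have expK: "K has_fps_expansion fps_shift 1 F"
    using \<open>K has_fps_expansion fps_expansion K 0\<close> by simp
  have contK: "continuous_on {0..2 * pi} (\<lambda>t. K (of_real r * cis t))"
    using holK r by (rule continuous_on_circle)
  have mean0: "((\<lambda>t. of_real r * cis t * K (of_real r * cis t)) has_integral 0) {0..2 * pi}"
    using circle_mean_value[OF holomorphic_on_mult[OF holomorphic_on_ident holK] r] by simp
  have add: "(cmod (a + w))\<^sup>2 = (cmod a)\<^sup>2 + (cmod w)\<^sup>2 + 2 * Re (cnj a * w)" for a w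
    unfolding cmod_power2 by (simp add: power2_eq_square algebra_simps)
  have "(cmod (H (of_real r * cis t)))\<^sup>2 =
          (cmod ?c)\<^sup>2 + r\<^sup>2 * (cmod (K (of_real r * cis t)))\<^sup>2 + 2 * Re (cnj ?c * (of_real r * cis t * K (of_real r * cis t)))" for t
    unfolding K[of "of_real r * cis t"] add using r by (simp add: norm_mult power_mult_distrib)
  moreover have "((\<lambda>t. (cmod ?c)\<^sup>2 + r\<^sup>2 * (cmod (K (of_real r * cis t)))\<^sup>2
                  + 2 * Re (cnj ?c * (of_real r * cis t * K (of_real r * cis t)))) has_integral
       2 * pi * (cmod ?c)\<^sup>2 + r\<^sup>2 * integral {0..2 * pi} (\<lambda>t. (cmod (K (of_real r * cis t)))\<^sup>2) + 2 * Re (cnj ?c * 0)) {0..2 * pi}"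
    using has_integral_const_real[of "(cmod ?c)\<^sup>2" 0 "2 * pi"]
    by (intro has_integral_add has_integral_mult_right has_integral_Re mean0 integrable_integral
          integrable_continuous_real continuous_intros contK) simp
  ultimately have "integral {0..2 * pi} (\<lambda>t. (cmod (H (of_real r * cis t)))\<^sup>2) =
      2 * pi * (cmod ?c)\<^sup>2 + r\<^sup>2 * integral {0..2 * pi} (\<lambda>t. (cmod (K (of_real r * cis t)))\<^sup>2)"
    by (simp add: integral_unique)
  moreover have "r\<^sup>2 * (2 * pi * (\<Sum>n<N. (cmod (fps_nth (fps_shift 1 F) n))\<^sup>2 * r ^ (2 * n)))
      \<le> r\<^sup>2 * integral {0..2 * pi} (\<lambda>t. (cmod (K (of_real r * cis t)))\<^sup>2)"
    by (intro mult_left_mono Suc.IH holK expK) auto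
  ultimately show ?case
    unfolding sum.lessThan_Suc_shift by (simp add: sum_distrib_left algebra_simps power2_eq_square)
qed

section \<open>The area theorem\<close>

text \<open>
  On \<open>|z| = r\<close> one has \<open>z = r\<^sup>2 * cnj (1 / z)\<close>, so there \<open>1 / z + h z\<close> differs from the point \<open>L (1 / z)\<close>
  of an ellipse, \<open>L v = v + h'(0) r\<^sup>2 * cnj v\<close>, only by the quadratic remainder of \<open>h\<close>. Hence the image
  of the circle does not meet the exterior \<open>V\<close> of a slightly larger ellipse. Let \<open>U\<close> be the image of
  the punctured disc of radius \<open>r\<close>. It meets \<open>V\<close> near infinity, and \<open>V\<close> contains no frontier point of
  \<open>U\<close>; as \<open>V\<close> is connected, \<open>V \<subseteq> U\<close>. By injectivity points outside the small disc are mapped outside \<open>U\<close>,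
  hence into the ellipse.
\<close>

lemma image_off_small_disc_in_ellipse:
  assumes hol: "h holomorphic_on ball 0 1" and h0: "h 0 = 0"
    and inj: "inj_on (\<lambda>z. 1 / z + h z) (ball 0 1 - {0})"
  shows "\<exists>M\<ge>0. \<exists>r0. 0 < r0 \<and> (\<forall>r z. 0 < r \<and> r < r0 \<longrightarrow>
           cmod (deriv h 0 * (of_real r)\<^sup>2) < 1 / 2 \<and>
           (r \<le> cmod z \<and> cmod z < 1 \<longrightarrow>
             1 / z + h z \<in> (\<lambda>v. v + deriv h 0 * (of_real r)\<^sup>2 * cnj v) ` cball 0 (1 / r + M * r\<^sup>2)))"
proof -
  define b where "b = deriv h 0"
  define g where "g = (\<lambda>z. 1 / z + h z)"
  define k where "k = (\<lambda>z. if z = 0 then b else h z / z)"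
  define m where "m = (\<lambda>z. if z = 0 then deriv k 0 else (k z - b) / z)"
  have holk: "k holomorphic_on ball 0 1"
    using difference_quotient_holomorphic[OF hol] by (simp only: k_def b_def h0 diff_zero)
  have holm: "m holomorphic_on ball 0 1"
    using difference_quotient_holomorphic[OF holk] by (simp only: m_def k_def if_True simp_thms)
  (* m is the second difference quotient of h at 0; its bound controls the quadratic remainder. *)
  have hm: "h z = b * z + z\<^sup>2 * m z" for z
    by (simp add: m_def k_def h0 power2_eq_square field_simps)
  have contm: "continuous_on (cball 0 (1/2)) m" and conth: "continuous_on (cball 0 (1/2)) h"
    by (auto intro!: holomorphic_on_imp_continuous_on holomorphic_on_subset[OF holm] holomorphic_on_subset[OF hol])
  obtain M0 where M0: "\<And>z. z \<in> cball 0 (1/2) \<Longrightarrow> cmod (m z) \<le> M0"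
    using compact_imp_bounded[OF compact_continuous_image[OF contm compact_cball]]
    unfolding bounded_iff by blast
  obtain B where B: "\<And>z. z \<in> cball 0 (1/2) \<Longrightarrow> cmod (h z) \<le> B"
    using compact_imp_bounded[OF compact_continuous_image[OF conth compact_cball]]
    unfolding bounded_iff by blast
  have M0nn: "M0 \<ge> 0" using M0[of 0] norm_ge_zero[of "m 0"] by (simp add: order_trans[of 0 "cmod (m 0)"])
  have Bnn: "B \<ge> 0" using B[of 0] by (simp add: h0)
  (* This choice of r0 keeps L within a factor 2 of an isometry, see Llow and Lup below. *)
  define r0 where "r0 = min (1/2) (1 / (2 * (cmod b + 1)))"
  have r0: "0 < r0" "r0 \<le> 1/2"
    by (auto simp: r0_def add_nonneg_pos)
  have small: "cmod (b * (of_real r)\<^sup>2) < 1 / 2" if "0 < r" "r < r0" for r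
  proof -
    have "0 < 2 * (cmod b + 1)"
      by (simp add: add_nonneg_pos)
    moreover have "r < 1 / (2 * (cmod b + 1))" and "r \<le> 1"
      using that by (simp_all add: r0_def)
    ultimately have lt: "r * (2 * (cmod b + 1)) < 1"
      by (simp add: pos_less_divide_eq)
    have "r\<^sup>2 * cmod b \<le> r * (cmod b + 1)"
      using that \<open>r \<le> 1\<close> by (intro mult_mono) (auto simp: power2_eq_square mult_left_le)
    moreover have "cmod (b * (of_real r)\<^sup>2) = r\<^sup>2 * cmod b"
      by (simp add: norm_mult norm_power)
    ultimately show ?thesis
      using lt by (simp add: algebra_simps)
  qed
  have large: "cmod (g z) \<ge> 1 / cmod z - B" if "cmod z \<le> 1/2" for z
    using norm_diff_ineq[of "1/z" "h z"] B[of z] that by (simp add: g_def norm_divide)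
  have main: "g z0 \<in> (\<lambda>v. v + b * (of_real r)\<^sup>2 * cnj v) ` cball 0 (1 / r + 2 * M0 * r\<^sup>2)"
    if r: "0 < r" "r < r0" and z0: "r \<le> cmod z0" "cmod z0 < 1" for r z0
  proof (rule ccontr)
    define c where "c = b * (of_real r)\<^sup>2"
    define L where "L = (\<lambda>v. v + c * cnj v)"
    define R where "R = 1 / r + 2 * M0 * r\<^sup>2"
    define U where "U = g ` (ball 0 r - {0})"
    define V where "V = L ` (- cball 0 R)"
    assume "g z0 \<notin> (\<lambda>v. v + b * (of_real r)\<^sup>2 * cnj v) ` cball 0 (1 / r + 2 * M0 * r\<^sup>2)"
    then have notin: "g z0 \<notin> L ` cball 0 R"
      by (simp add: L_def c_def R_def)
    have c: "cmod c < 1/2" using small[OF r] by (simp add: c_def)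
    have r1: "r < 1/2" using r r0 by simp
    have Llow: "cmod v / 2 \<le> cmod (L v)" for v
    proof -
      have "cmod (c * cnj v) \<le> 1/2 * cmod v"
        unfolding norm_mult complex_mod_cnj using c by (intro mult_right_mono) auto
      then show ?thesis
        using norm_diff_ineq[of v "c * cnj v"] by (simp add: L_def)
    qed
    have Lup: "cmod (L v) \<le> 2 * cmod v" for v
    proof -
      have "cmod (c * cnj v) \<le> 1 * cmod v"
        unfolding norm_mult complex_mod_cnj using c by (intro mult_right_mono) auto
      then show ?thesis
        using norm_triangle_ineq[of v "c * cnj v"] by (simp add: L_def)
    qed
    have Lsurj: "\<exists>v. w = L v" for w
    proof -
      have "(cmod c)\<^sup>2 < 1" using c by (simp add: power_less_one_iff abs_square_less_1)
      then have "1 - c * cnj c \<noteq> 0"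
        by (metis complex_norm_square eq_iff_diff_eq_0 less_irrefl of_real_1 of_real_eq_iff)
      then have "w = L ((w - c * cnj w) / (1 - c * cnj c))"
        by (simp add: L_def divide_simps) (simp add: algebra_simps)
      then show ?thesis by blast
    qed
    have Ldiff: "L (u - v) = L u - L v" for u v
      by (simp add: L_def algebra_simps)
    have inV: "L v \<in> V \<longleftrightarrow> R < cmod v" for v
    proof -
      have "u = v" if "L u = L v" for u
        using Llow[of "u - v"] that by (simp add: Ldiff)
      then show ?thesis by (auto simp: V_def not_le)
    qed
    (* The exterior of a bounded convex set in the plane is connected, and L preserves this. *)
    have "connected V"
      unfolding V_def L_def
      by (intro connected_continuous_image continuous_intros connected_complement_bounded_convex) auto
    have holg: "g holomorphic_on ball 0 1 - {0}"
      unfolding g_def by (intro holomorphic_intros holomorphic_on_subset[OF hol]) auto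
    have "open U"
      unfolding U_def
      by (rule open_mapping_thm3)
        (use r1 in \<open>auto intro!: holomorphic_on_subset[OF holg] inj_on_subset[OF inj[folded g_def]]\<close>)
    have "g z0 \<notin> U"
    proof
      assume "g z0 \<in> U"
      then obtain z where z: "z \<in> ball 0 r - {0}" "g z0 = g z"
        unfolding U_def by blast
      then have "z0 = z"
        using inj z0 r r1 unfolding g_def by (auto dest: inj_onD)
      then show False using z z0 by auto
    qed
    moreover have "g z0 \<in> V"
      using Lsurj[of "g z0"] notin by (auto simp: V_def)
    moreover have "V \<inter> U \<noteq> {}"
    proof -
      define t where "t = min (r / 2) (1 / (2 * R + B + 1))"
      have Rnn: "R \<ge> 0" using M0nn r by (simp add: R_def)
      have t: "0 < t" "t < r" "t \<le> 1 / (2 * R + B + 1)"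
        using r Rnn Bnn by (auto simp: t_def)
      have "1 / t \<ge> 2 * R + B + 1"
        using t Rnn Bnn by (simp add: field_simps)
      with large[of "of_real t"] have "cmod (g (of_real t)) > 2 * R"
        using t r1 by simp
      moreover obtain v where v: "g (of_real t) = L v" using Lsurj by blast
      ultimately have "g (of_real t) \<in> V"
        using Lup[of v] inV[of v] by simp
      moreover have "g (of_real t) \<in> U"
        using t by (auto simp: U_def)
      ultimately show ?thesis by blast
    qed
    ultimately have "V \<inter> frontier U \<noteq> {}"
      using connected_Int_frontier[OF \<open>connected V\<close>, of U] by blast
    then obtain x where x: "x \<in> V" "x \<in> closure U" "x \<notin> U"
      using \<open>open U\<close> by (auto simp: frontier_def interior_open)
    (* Points of modulus below d have images too far out to approach x, so x is a limit of values
       taken on the compact annulus between d and r. *)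
    define d where "d = min (r / 2) (1 / (cmod x + B + 1))"
    have d: "0 < d" "d < r" "d \<le> 1 / (cmod x + B + 1)"
      using r Bnn by (auto simp: d_def add_nonneg_pos)
    let ?A = "cball 0 r - ball 0 d :: complex set"
    have "U \<subseteq> g ` ?A \<union> {w. cmod w \<ge> cmod x + 1}"
    proof
      fix w assume "w \<in> U"
      then obtain z where "z \<in> ball 0 r - {0}" and w: "w = g z"
        unfolding U_def by blast
      then have z: "z \<noteq> 0" "cmod z < r"
        by auto
      show "w \<in> g ` ?A \<union> {w. cmod w \<ge> cmod x + 1}"
      proof (cases "cmod z < d")
        case True
        moreover have "0 < cmod x + B + 1"
          using Bnn by (simp add: add_nonneg_pos)
        ultimately have "cmod z * (cmod x + B + 1) \<le> 1"
          using d(3) by (simp flip: pos_le_divide_eq)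
        then have "cmod x + B + 1 \<le> 1 / cmod z"
          using z by (simp add: field_simps)
        with large[of z] z r1 w show ?thesis by simp
      next
        case False
        then show ?thesis using z w by auto
      qed
    qed
    moreover have "closed (g ` ?A)"
      using d r1 by (intro compact_imp_closed compact_continuous_image compact_diff
           holomorphic_on_imp_continuous_on holomorphic_on_subset[OF holg]) auto
    moreover have "closed {w::complex. cmod w \<ge> cmod x + 1}"
      by (intro closed_Collect_le continuous_intros)
    ultimately have "closure U \<subseteq> g ` ?A \<union> {w. cmod w \<ge> cmod x + 1}"
      by (rule closure_minimal[OF _ closed_Un])
    then obtain z where z: "x = g z" "d \<le> cmod z" "cmod z \<le> r"
      using x(2) by auto
    with x(3) d have zr: "cmod z = r"
      by (force simp: U_def)
    obtain v where v: "x = L v" using Lsurj by blast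
    have "z * cnj z = of_real (r\<^sup>2)"
      using complex_norm_square[of z] zr by simp
    moreover have "z \<noteq> 0" using z d by auto
    ultimately have "(of_real r)\<^sup>2 * cnj (1 / z) = z"
      by (simp add: field_simps) 
    then have "L (1 / z) = 1 / z + b * z"
      by (simp add: L_def c_def mult.assoc)
    then have "L (v - 1 / z) = z\<^sup>2 * m z"
      using z(1) v hm[of z] by (simp add: Ldiff g_def)
    then have "cmod (v - 1 / z) \<le> 2 * (r\<^sup>2 * M0)"
      using Llow[of "v - 1 / z"] mult_left_mono[OF M0[of z], of "r\<^sup>2"] zr r1
      by (simp add: norm_mult norm_power)
    then have "cmod v \<le> R"
      using norm_triangle_ineq[of "1 / z" "v - 1 / z"] zr
      by (simp add: R_def norm_divide algebra_simps)
    then show False using inV x(1) v by simp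
  qed
  show ?thesis
    using M0nn r0(1) small main unfolding b_def g_def
    by (intro exI[of _ "2 * M0"] exI[of _ r0]) auto
qed

text \<open>
  The annulus \<open>r < |z| < \<rho>\<close>, cut along a radius, is the exponential image of a rectangle. This replaces
  polar coordinates: with \<open>G \<zeta> = g (exp \<zeta>)\<close> and \<open>z = exp \<zeta>\<close>, where \<open>g z = q z / z\<close> up to a constant, one has
  \<open>G' \<zeta> = (z q' z - q z) / z\<close>. The \<open>n\<close>-th coefficient of \<open>z q' - q\<close> is \<open>n - 1\<close> times that of \<open>q\<close>, which
  puts the pole term \<open>n = 0\<close> and the others on the same footing. Coefficients of \<open>q z = z * g z\<close> are shifted by
  one against those of \<open>g\<close>.
\<close>

lemma area_theorem_annulus:
  assumes hol: "q holomorphic_on ball 0 1" and q: "q has_fps_expansion Q"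
    and Q0: "fps_nth Q 0 = 1" and inj: "inj_on (\<lambda>z. q z / z) (ball 0 1 - {0})"
  shows "\<exists>M r0. 0 < r0 \<and> (\<forall>r \<rho>. 0 < r \<and> r < r0 \<and> r < \<rho> \<and> \<rho> < 1 \<longrightarrow>
    (\<Sum>m<N. m * (cmod (fps_nth Q (Suc m)))\<^sup>2 * \<rho> ^ (2 * m)) - 1 / \<rho>\<^sup>2
      \<le> (\<Sum>m<N. m * (cmod (fps_nth Q (Suc m)))\<^sup>2 * r ^ (2 * m)) + 2 * M * r + M\<^sup>2 * r ^ 4)"
proof -
  have q0: "q 0 = 1" and q1: "deriv q 0 = fps_nth Q 1"
    using fps_nth_fps_expansion[OF q, of 0] fps_nth_fps_expansion[OF q, of 1] Q0 by simp_all
  define h where "h = (\<lambda>z. (if z = 0 then deriv q 0 else (q z - q 0) / z) - fps_nth Q 1)"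
  have holh: "h holomorphic_on ball 0 1"
    unfolding h_def by (intro holomorphic_on_diff difference_quotient_holomorphic hol holomorphic_on_const)
  have h0: "h 0 = 0" by (simp add: h_def q1)
  have g: "1 / z + h z = q z / z - fps_nth Q 1" if "z \<noteq> 0" for z
    using that by (simp add: h_def q0 diff_divide_distrib)
  have injh: "inj_on (\<lambda>z. 1 / z + h z) (ball 0 1 - {0})"
    using inj by (auto simp: inj_on_def g)
  obtain M r0 where r0: "0 \<le> M" "0 < r0"
    and small: "\<And>r. 0 < r \<Longrightarrow> r < r0 \<Longrightarrow> cmod (deriv h 0 * (of_real r)\<^sup>2) < 1 / 2"
    and ellipse: "\<And>r z. 0 < r \<Longrightarrow> r < r0 \<Longrightarrow> r \<le> cmod z \<Longrightarrow> cmod z < 1 \<Longrightarrow>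
       1 / z + h z \<in> (\<lambda>v. v + deriv h 0 * (of_real r)\<^sup>2 * cnj v) ` cball 0 (1 / r + M * r\<^sup>2)"
    using image_off_small_disc_in_ellipse[OF holh h0 injh] by meson
  define H where "H = (\<lambda>z. z * deriv q z - q z)"
  define C where "C = (\<lambda>n. (cmod (fps_nth Q n))\<^sup>2)"
  have holH: "H holomorphic_on ball 0 1"
    unfolding H_def by (intro holomorphic_intros hol) auto
  have expH: "H has_fps_expansion fps_X * fps_deriv Q - Q"
    unfolding H_def by (intro fps_expansion_intros q)
  have cH: "(cmod (fps_nth (fps_X * fps_deriv Q - Q) n))\<^sup>2 = (real n - 1)\<^sup>2 * C n" for n
  proof -
    have "fps_nth (fps_X * fps_deriv Q - Q) n = of_real (real n - 1) * fps_nth Q n"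
      by (cases n) (simp_all add: algebra_simps)
    then show ?thesis
      by (simp only: norm_mult norm_of_real power_mult_distrib power2_abs C_def)
  qed
  (* Antiderivative, in the variable s = ln |z|, of the lower bound from Bessel's inequality. *)
  define P where "P = (\<lambda>s. \<Sum>n<Suc N. pi * (real n - 1) * C n * exp (2 * (real n - 1) * s))"
  have P_ln: "P (ln x) = pi * ((\<Sum>m<N. m * C (Suc m) * x ^ (2 * m)) - 1 / x\<^sup>2)" if "0 < x" for x
  proof -
    have "exp (2 * real m * ln x) = x ^ (2 * m)" for m
      using exp_of_nat_mult[of "2 * m" "ln x"] that by simp
    moreover have "exp (- 2 * ln x) = 1 / x\<^sup>2"
      using that exp_of_nat_mult[of 2 "ln x"] by (simp add: exp_minus field_simps)
    moreover have "C 0 = 1" by (simp add: C_def Q0)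
    ultimately show ?thesis
      unfolding P_def sum.lessThan_Suc_shift
      by (simp add: sum_distrib_left algebra_simps)
  qed
  have area: "P (ln \<rho>) - P (ln r) \<le> pi * (1 / r + M * r\<^sup>2)\<^sup>2"
    if r: "0 < r" "r < r0" "r < \<rho>" "\<rho> < 1" for r \<rho>
  proof -
    define G where "G = (\<lambda>\<zeta>. q (exp \<zeta>) * exp (- \<zeta>) - fps_nth Q 1)"
    define A where "A = {\<zeta>. Re \<zeta> < 0}"
    let ?B = "box (Complex (ln r) 0) (Complex (ln \<rho>) (2 * pi))"
    let ?c = "deriv h 0 * (of_real r)\<^sup>2"
    have "open A" unfolding A_def by (intro open_Collect_less continuous_intros)
    have expA: "exp \<zeta> \<in> ball 0 1" if "\<zeta> \<in> A" for \<zeta>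
      using that by (simp add: A_def)
    have derG: "(G has_field_derivative exp (- \<zeta>) * H (exp \<zeta>)) (at \<zeta>)" if "\<zeta> \<in> A" for \<zeta>
    proof -
      have "(q has_field_derivative deriv q (exp \<zeta>)) (at (exp \<zeta>))"
        using holomorphic_derivI[OF hol open_ball expA[OF that]] .
      from DERIV_chain2[OF this DERIV_exp] show ?thesis
        unfolding G_def H_def
        by (auto intro!: derivative_eq_intros simp: algebra_simps)
    qed
    then have "G holomorphic_on A"
      using holomorphic_on_open[OF \<open>open A\<close>] by blast
    have sub: "cbox (Complex (ln r) 0) (Complex (ln \<rho>) (2 * pi)) \<subseteq> A"
      using r by (auto simp: A_def in_cbox_complex_iff intro: le_less_trans)
    have BA: "?B \<subseteq> A" using sub box_subset_cbox by blast
    have Gg: "G \<zeta> = 1 / exp \<zeta> + h (exp \<zeta>)" for \<zeta>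
      using g[of "exp \<zeta>"] by (simp add: G_def exp_minus divide_inverse)
    have injG: "inj_on G ?B"
    proof (rule inj_onI)
      fix \<zeta> \<eta> assume B: "\<zeta> \<in> ?B" "\<eta> \<in> ?B" and "G \<zeta> = G \<eta>"
      then have "q (exp \<zeta>) / exp \<zeta> = q (exp \<eta>) / exp \<eta>"
        by (simp add: G_def exp_minus divide_inverse)
      moreover have "exp \<zeta> \<in> ball 0 1" "exp \<eta> \<in> ball 0 1"
        using expA[OF subsetD[OF BA]] B by simp_all
      ultimately have "exp \<zeta> = exp \<eta>"
        using inj by (auto dest!: inj_onD)
      moreover have "\<bar>Im \<zeta> - Im \<eta>\<bar> < 2 * pi"
        using B by (auto simp: in_box_complex_iff)
      ultimately show "\<zeta> = \<eta>"
        by (rule exp_complex_eqI[rotated])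
    qed
    note im = measure_holomorphic_image_box[OF \<open>G holomorphic_on A\<close> \<open>open A\<close> sub injG]
    have "G ` ?B \<subseteq> (\<lambda>v. v + ?c * cnj v) ` cball 0 (1 / r + M * r\<^sup>2)"
    proof
      fix w assume "w \<in> G ` ?B"
      then obtain \<zeta> where \<zeta>: "\<zeta> \<in> ?B" "w = G \<zeta>" by blast
      have "ln r \<le> Re \<zeta>"
        using \<zeta> by (simp add: in_box_complex_iff)
      then have "r \<le> cmod (exp \<zeta>)"
        using r exp_le_cancel_iff[of "ln r" "Re \<zeta>"] by simp
      moreover have "cmod (exp \<zeta>) < 1"
        using expA BA \<zeta>(1) by auto
      ultimately show "w \<in> (\<lambda>v. v + ?c * cnj v) ` cball 0 (1 / r + M * r\<^sup>2)"
        unfolding \<zeta>(2) Gg using ellipse r by blast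
    qed
    then have "measure lebesgue (plane_vec ` G ` ?B)
                 \<le> measure lebesgue (plane_vec ` (\<lambda>v. v + ?c * cnj v) ` cball 0 (1 / r + M * r\<^sup>2))"
      using im(1) measure_ellipse(1)[of "1 / r + M * r\<^sup>2" ?c] r r0
      by (intro measure_mono_fmeasurable image_mono) (auto simp: fmeasurableD)
    also have "\<dots> = \<bar>1 - (cmod ?c)\<^sup>2\<bar> * (pi * (1 / r + M * r\<^sup>2)\<^sup>2)"
      using r r0 by (intro measure_ellipse(2)) auto
    also have "\<dots> \<le> 1 * (pi * (1 / r + M * r\<^sup>2)\<^sup>2)"
    proof (rule mult_right_mono)
      have "(cmod ?c)\<^sup>2 \<le> 1"
        using small[OF r(1,2)] by (intro power_le_one) auto
      then show "\<bar>1 - (cmod ?c)\<^sup>2\<bar> \<le> 1" by simp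
    qed auto
    finally have upper: "measure lebesgue (plane_vec ` G ` ?B) \<le> pi * (1 / r + M * r\<^sup>2)\<^sup>2"
      by simp
    have inner: "(\<Sum>n<Suc N. 2 * pi * (real n - 1)\<^sup>2 * C n * exp (2 * (real n - 1) * s))
        \<le> integral {0..2 * pi} (\<lambda>t. (cmod (deriv G (Complex s t)))\<^sup>2)" if s: "s \<in> {ln r..ln \<rho>}" for s
    proof -
      have "s < 0" using s r by (auto intro: le_less_trans)
      have dG: "(cmod (deriv G (Complex s t)))\<^sup>2 = exp (- 2 * s) * (cmod (H (of_real (exp s) * cis t)))\<^sup>2" for t
      proof -
        have "deriv G (Complex s t) = exp (- Complex s t) * H (exp (Complex s t))"
          using derG[of "Complex s t"] \<open>s < 0\<close> by (intro DERIV_imp_deriv) (simp add: A_def)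
        moreover have "exp (Complex s t) = of_real (exp s) * cis t"
          by (simp add: exp_eq_polar)
        moreover have "(exp (- s))\<^sup>2 = exp (- 2 * s)"
          by (simp add: power2_eq_square flip: exp_add)
        ultimately show ?thesis
          by (simp add: norm_mult power_mult_distrib)
      qed
      have "exp (- 2 * s) * (2 * pi * (\<Sum>n<Suc N. (real n - 1)\<^sup>2 * C n * exp s ^ (2 * n)))
              \<le> exp (- 2 * s) * integral {0..2 * pi} (\<lambda>t. (cmod (H (of_real (exp s) * cis t)))\<^sup>2)"
        using circle_bessel[OF holH expH, of "exp s" "Suc N"] \<open>s < 0\<close> unfolding cH
        by (intro mult_left_mono) auto
      also have "\<dots> = integral {0..2 * pi} (\<lambda>t. (cmod (deriv G (Complex s t)))\<^sup>2)"
        by (simp add: dG)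
      also have "exp (- 2 * s) * (2 * pi * (\<Sum>n<Suc N. (real n - 1)\<^sup>2 * C n * exp s ^ (2 * n)))
          = (\<Sum>n<Suc N. 2 * pi * (real n - 1)\<^sup>2 * C n * exp (2 * (real n - 1) * s))"
      proof -
        have "exp (- 2 * s) * exp s ^ (2 * n) = exp (2 * (real n - 1) * s)" for n
          by (simp add: algebra_simps flip: exp_of_nat_mult exp_add)
        then show ?thesis
          unfolding sum_distrib_left by (intro sum.cong) (auto simp: mult_ac)
      qed
      finally show ?thesis .
    qed
    have "(P has_real_derivative (\<Sum>n<Suc N. 2 * pi * (real n - 1)\<^sup>2 * C n * exp (2 * (real n - 1) * s))) (at s within S)" for s S
      unfolding P_def
      by (rule DERIV_sum) (auto intro!: derivative_eq_intros simp: power2_eq_square)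
    then have "((\<lambda>s. \<Sum>n<Suc N. 2 * pi * (real n - 1)\<^sup>2 * C n * exp (2 * (real n - 1) * s)) has_integral
            P (ln \<rho>) - P (ln r)) {ln r..ln \<rho>}"
      using r by (intro fundamental_theorem_of_calculus) (auto simp: has_real_derivative_iff_has_vector_derivative)
    from has_integral_le[OF this integrable_integral[OF im(3)] inner]
    have "P (ln \<rho>) - P (ln r) \<le> integral {ln r..ln \<rho>} (\<lambda>s. integral {0..2 * pi} (\<lambda>t. (cmod (deriv G (Complex s t)))\<^sup>2))"
      by simp
    with im(2) upper show ?thesis by simp
  qed
  show ?thesis
  proof (rule exI[of _ M], rule exI[of _ r0], intro conjI allI impI)
    fix r \<rho> :: real assume "0 < r \<and> r < r0 \<and> r < \<rho> \<and> \<rho> < 1"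
    then have r: "0 < r" "r < r0" "r < \<rho>" "\<rho> < 1" by auto
    let ?S = "\<lambda>x. \<Sum>m<N. m * C (Suc m) * x ^ (2 * m)"
    have "pi * ((?S \<rho> - 1 / \<rho>\<^sup>2) - (?S r - 1 / r\<^sup>2)) \<le> pi * (1 / r + M * r\<^sup>2)\<^sup>2"
      using area[OF r] r by (simp add: P_ln algebra_simps)
    then have "(?S \<rho> - 1 / \<rho>\<^sup>2) - (?S r - 1 / r\<^sup>2) \<le> (1 / r + M * r\<^sup>2)\<^sup>2"
      by simp
    also have "(1 / r + M * r\<^sup>2)\<^sup>2 = 1 / r\<^sup>2 + 2 * M * r + M\<^sup>2 * r ^ 4"
      using r by (simp add: field_simps power2_eq_square power4_eq_xxxx)
    finally show "(\<Sum>m<N. m * (cmod (fps_nth Q (Suc m)))\<^sup>2 * \<rho> ^ (2 * m)) - 1 / \<rho>\<^sup>2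
      \<le> (\<Sum>m<N. m * (cmod (fps_nth Q (Suc m)))\<^sup>2 * r ^ (2 * m)) + 2 * M * r + M\<^sup>2 * r ^ 4"
      by (simp add: C_def)
  qed (use r0 in auto)
qed

text \<open>
  The estimate on the annulus survives the limits \<open>r \<rightarrow> 0\<close> and then \<open>\<rho> \<rightarrow> 1\<close>.
  Only finite sums occur, so both limits are those of continuous functions.
\<close>

theorem area_theorem:
  assumes "q holomorphic_on ball 0 1" "q has_fps_expansion Q"
    and "fps_nth Q 0 = 1" "inj_on (\<lambda>z. q z / z) (ball 0 1 - {0})"
  shows "(\<Sum>m<N. m * (cmod (fps_nth Q (Suc m)))\<^sup>2) \<le> 1"
proof -
  define S where "S = (\<lambda>x. \<Sum>m<N. m * (cmod (fps_nth Q (Suc m)))\<^sup>2 * x ^ (2 * m))"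
  obtain M r0 where r0: "0 < r0" and ineq: "\<And>r \<rho>. 0 < r \<Longrightarrow> r < r0 \<Longrightarrow> r < \<rho> \<Longrightarrow> \<rho> < 1 \<Longrightarrow>
      S \<rho> - 1 / \<rho>\<^sup>2 \<le> S r + 2 * M * r + M\<^sup>2 * r ^ 4"
    unfolding S_def using area_theorem_annulus[OF assms, of N] by meson
  have contS: "isCont S x" for x
    unfolding S_def by (intro continuous_intros)
  have "S 0 = 0"
    unfolding S_def by (intro sum.neutral) (auto simp: power_0_left)
  have le: "S \<rho> - 1 / \<rho>\<^sup>2 \<le> 0" if "0 < \<rho>" "\<rho> < 1" for \<rho>
  proof (rule tendsto_lowerbound)
    have "((\<lambda>r. S r + 2 * M * r + M\<^sup>2 * r ^ 4) \<longlongrightarrow> S 0 + 2 * M * 0 + M\<^sup>2 * 0 ^ 4) (at_right 0)"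
      by (intro tendsto_intros tendsto_within_subset[OF contS[unfolded isCont_def]]) auto
    then show "((\<lambda>r. S r + 2 * M * r + M\<^sup>2 * r ^ 4) \<longlongrightarrow> 0) (at_right 0)"
      by (simp add: \<open>S 0 = 0\<close>)
    have "\<forall>\<^sub>F r in at_right 0. r \<in> {0<..<min r0 \<rho>}"
      using r0 that by (intro eventually_at_right_real) auto
    then show "\<forall>\<^sub>F r in at_right 0. S \<rho> - 1 / \<rho>\<^sup>2 \<le> S r + 2 * M * r + M\<^sup>2 * r ^ 4"
      by eventually_elim (use ineq that in auto)
  qed auto
  have "S 1 - 1 / 1\<^sup>2 \<le> 0"
  proof (rule tendsto_upperbound)
    show "((\<lambda>\<rho>. S \<rho> - 1 / \<rho>\<^sup>2) \<longlongrightarrow> S 1 - 1 / 1\<^sup>2) (at_left 1)"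
      by (intro tendsto_intros tendsto_within_subset[OF contS[unfolded isCont_def]]) auto
    have "\<forall>\<^sub>F \<rho> in at_left 1. \<rho> \<in> {0<..<1::real}"
      by (intro eventually_at_left_real) auto
    then show "\<forall>\<^sub>F \<rho> in at_left 1. S \<rho> - 1 / \<rho>\<^sup>2 \<le> 0"
      by eventually_elim (use le in auto)
  qed auto
  then show ?thesis by (simp add: S_def)
qed

section \<open>Logarithmic coefficients of inverse functions\<close>

lemma fps_compose_nth_1_2:
  fixes F G :: "complex fps"
  assumes "fps_nth G 0 = 0"
  shows "fps_nth (fps_compose F G) 1 = fps_nth F 1 * fps_nth G 1"
    and "fps_nth (fps_compose F G) 2 = fps_nth F 1 * fps_nth G 2 + fps_nth F 2 * (fps_nth G 1)\<^sup>2"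
  using assms
  by (simp_all add: fps_compose_nth fps_mult_nth numeral_2_eq_2)

lemma fps_compose_X_square_nth:
  fixes F :: "complex fps"
  shows "fps_nth (fps_compose F (fps_X\<^sup>2)) (2 * n) = fps_nth F n"
proof -
  have "fps_nth (fps_compose F (fps_X\<^sup>2)) (2 * n) = (\<Sum>i = 0..2 * n. if n = i then fps_nth F i else 0)"
    unfolding fps_compose_nth by (intro sum.cong) (auto simp flip: power_mult)
  then show ?thesis by simp
qed

lemma class_S_factor:
  assumes f: "f \<in> class_S"
  obtains p where "p holomorphic_on ball 0 1" "p 0 = 1" "\<And>z. z \<in> ball 0 1 \<Longrightarrow> p z \<noteq> 0"
    "\<And>z. f z = z * p z"
proof -
  have hol: "f holomorphic_on ball 0 1" and f0: "f 0 = 0" and "deriv f 0 = 1"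
    and inj: "inj_on f (ball 0 1)"
    using f by (auto simp: class_S_def class_A_def)
  define p where "p = (\<lambda>z. if z = 0 then deriv f 0 else (f z - f 0) / z)"
  show ?thesis
  proof (rule that[of p])
    show "p holomorphic_on ball 0 1"
      unfolding p_def by (rule difference_quotient_holomorphic[OF hol])
    show "p 0 = 1"
      by (simp add: p_def \<open>deriv f 0 = 1\<close>)
    show "f z = z * p z" for z
      by (simp add: p_def f0)
    show "p z \<noteq> 0" if "z \<in> ball 0 1" for z
    proof (cases "z = 0")
      case True
      then show ?thesis by (simp add: \<open>p 0 = 1\<close>)
    next
      case False
      then have "f z \<noteq> f 0"
        using inj_onD[OF inj, of z 0] that by auto
      then show ?thesis using False by (simp add: p_def)
    qed
  qed
qed

text \<open>
  The inverse function is avoided by substituting \<open>w = f z\<close>: then \<open>exp (log_inv f (f z)) * p z = 1\<close>, and the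
  first two coefficients of this identity of power series determine those of \<open>log_inv f\<close>.
\<close>

lemma inv_log_coeff_eq:
  assumes f: "f \<in> class_S" and p: "p has_fps_expansion P"
    and nz: "\<And>z. z \<in> ball 0 1 \<Longrightarrow> p z \<noteq> 0" and fp: "\<And>z. f z = z * p z" and P0: "fps_nth P 0 = 1"
  shows "inv_log_coeff f 1 = - fps_nth P 1 / 2"
    and "inv_log_coeff f 2 = (3 / 2 * (fps_nth P 1)\<^sup>2 - fps_nth P 2) / 2"
proof -
  let ?\<Lambda> = "fps_expansion (log_inv f) 0"
  define K where "K = fps_compose ?\<Lambda> (fps_X * P)"
  have inj: "inj_on f (ball 0 1)" using f by (simp add: class_S_def)
  have p0: "p 0 = 1"
    using fps_nth_fps_expansion[OF p, of 0] P0 by simp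
  have expL: "log_inv f has_fps_expansion ?\<Lambda>"
    using analytic_at_imp_has_fps_expansion_0[OF log_inv_analytic[OF f]] .
  have expf: "f has_fps_expansion fps_X * P"
    unfolding fp by (intro fps_expansion_intros p)
  have expK: "(log_inv f \<circ> f) has_fps_expansion K"
    unfolding K_def by (intro has_fps_expansion_compose expL expf) simp
  have logf: "exp (log_inv f (f z)) * p z = 1" if "z \<in> ball 0 1" for z
  proof (cases "z = 0")
    case True
    then show ?thesis by (simp add: log_inv_def p0 fp)
  next
    case False
    then have "f z \<noteq> 0" using nz[OF that] by (simp add: fp)
    moreover have "disk_inv f (f z) = z"
      unfolding disk_inv_def using inj that by (rule inv_into_f_f)
    ultimately show ?thesis
      using False nz[OF that] by (simp add: log_inv_def fp)
  qed
  have L0: "fps_nth ?\<Lambda> 0 = 0"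
    by (simp add: fps_expansion_def log_inv_def)
  have K0: "fps_nth K 0 = 0"
    by (simp add: K_def L0)
  have "(exp \<circ> (log_inv f \<circ> f)) has_fps_expansion fps_compose (fps_exp 1) K"
    by (intro has_fps_expansion_compose has_fps_expansion_exp1 expK K0)
  then have "(\<lambda>z. (exp \<circ> (log_inv f \<circ> f)) z * p z) has_fps_expansion fps_compose (fps_exp 1) K * P"
    by (intro has_fps_expansion_mult p)
  moreover have "\<forall>\<^sub>F z in nhds 0. (exp \<circ> (log_inv f \<circ> f)) z * p z = 1"
    using eventually_nhds_in_open[OF open_ball, of 0 0 1] logf by (auto elim!: eventually_mono)
  ultimately have "(\<lambda>z. 1) has_fps_expansion fps_compose (fps_exp 1) K * P"
    using has_fps_expansion_cong by force
  then have EP: "fps_compose (fps_exp 1) K * P = 1"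
    by (rule fps_expansion_unique_complex) simp
  define E where "E = fps_compose (fps_exp 1) K"
  have E0: "fps_nth E 0 = 1"
    by (simp add: E_def)
  have E: "fps_nth E 1 = fps_nth K 1" "fps_nth E 2 = fps_nth K 2 + (fps_nth K 1)\<^sup>2 / 2"
    unfolding E_def by (simp_all only: fps_compose_nth_1_2[OF K0]) (simp_all add: numeral_2_eq_2)
  have "fps_nth (E * P) 1 = 0" "fps_nth (E * P) 2 = 0"
    using EP by (simp_all add: E_def)
  then have eqs: "fps_nth E 1 + fps_nth P 1 = 0" "fps_nth E 2 + fps_nth E 1 * fps_nth P 1 + fps_nth P 2 = 0"
    using E0 P0 by (simp_all add: fps_mult_nth numeral_2_eq_2 algebra_simps)
  have K: "fps_nth K 1 = fps_nth ?\<Lambda> 1" "fps_nth K 2 = fps_nth ?\<Lambda> 1 * fps_nth P 1 + fps_nth ?\<Lambda> 2"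
  proof -
    have XP: "fps_nth (fps_X * P) 0 = 0" "fps_nth (fps_X * P) 1 = 1" "fps_nth (fps_X * P) 2 = fps_nth P 1"
      using P0 by (simp_all add: numeral_2_eq_2)
    show "fps_nth K 1 = fps_nth ?\<Lambda> 1" "fps_nth K 2 = fps_nth ?\<Lambda> 1 * fps_nth P 1 + fps_nth ?\<Lambda> 2"
      unfolding K_def fps_compose_nth_1_2[OF XP(1)] XP by simp_all
  qed
  have L1: "fps_nth ?\<Lambda> 1 = - fps_nth P 1"
    using eqs(1) E(1) K(1) by (simp add: eq_neg_iff_add_eq_0)
  have "fps_nth ?\<Lambda> 2 = 3 / 2 * (fps_nth P 1)\<^sup>2 - fps_nth P 2"
    using eqs(2) unfolding E K L1 by (simp add: field_simps power2_eq_square)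
  then show "inv_log_coeff f 2 = (3 / 2 * (fps_nth P 1)\<^sup>2 - fps_nth P 2) / 2"
    by (simp add: inv_log_coeff_def)
  show "inv_log_coeff f 1 = - fps_nth P 1 / 2"
    using L1 by (simp add: inv_log_coeff_def)
qed

text \<open>
  Here \<open>u\<close> and \<open>v\<close> are the first two coefficients of \<open>s\<close>, the square root of \<open>z / f z\<close> with \<open>s 0 = 1\<close>. The
  two inequalities are the area theorem for \<open>(s z)\<^sup>2 / z = 1 / f z\<close> and for \<open>s (z\<^sup>2) / z\<close>. The latter is
  injective because its square is \<open>1 / f (z\<^sup>2)\<close>: equal values at \<open>z\<close> and \<open>w\<close> force \<open>z\<^sup>2 = w\<^sup>2\<close>, hence
  equal numerators and so equal denominators.
\<close>

lemma class_S_inv_log_coeffs: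
  assumes f: "f \<in> class_S"
  obtains u v where "inv_log_coeff f 1 = u" "inv_log_coeff f 2 = (3 * u\<^sup>2 + 2 * v) / 2"
    "cmod (u\<^sup>2 + 2 * v) \<le> 1" "(cmod u)\<^sup>2 + 3 * (cmod v)\<^sup>2 \<le> 1"
proof -
  obtain p where p: "p holomorphic_on ball 0 1" "p 0 = 1" 
    and nz: "\<And>z. z \<in> ball 0 1 \<Longrightarrow> p z \<noteq> 0" and fp: "\<And>z. f z = z * p z"
    using class_S_factor[OF f] by metis
  have inj: "inj_on f (ball 0 1)" using f by (simp add: class_S_def)
  have holr: "(\<lambda>z. 1 / p z) holomorphic_on ball 0 1"
    using p nz by (intro holomorphic_intros) auto
  have nzr: "1 / p z \<noteq> 0" if "z \<in> ball 0 1" for z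
    using nz[OF that] by simp
  obtain g where g: "g holomorphic_on ball 0 1" "\<And>z. z \<in> ball 0 1 \<Longrightarrow> 1 / p z = (g z)\<^sup>2"
    using contractible_imp_holomorphic_sqrt[OF holr convex_imp_contractible[OF convex_ball]] nzr by blast
  (* g 0 is 1 or -1; multiplying by it selects the branch with value 1 at the origin. *)
  define s where "s = (\<lambda>z. g 0 * g z)"
  have hols: "s holomorphic_on ball 0 1"
    unfolding s_def by (intro holomorphic_intros g)
  have g0: "(g 0)\<^sup>2 = 1" using g(2)[of 0] p by simp
  then have s0: "s 0 = 1" by (simp add: s_def power2_eq_square)
  have s2: "(s z)\<^sup>2 * p z = 1" if "z \<in> ball 0 1" for z
    using g(2)[OF that] nz[OF that] g0 by (simp add: s_def power_mult_distrib flip: g(2)[OF that])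
  define P where "P = fps_expansion p 0"
  define S where "S = fps_expansion s 0"
  have expP: "p has_fps_expansion P" and expS: "s has_fps_expansion S"
    unfolding P_def S_def using p hols by (auto intro!: has_fps_expansion_fps_expansion[of "ball 0 1"])
  have P0: "fps_nth P 0 = 1" and S0: "fps_nth S 0 = 1"
    using fps_nth_fps_expansion[OF expP, of 0] fps_nth_fps_expansion[OF expS, of 0] p s0 by simp_all
  have "(\<lambda>z. (s z)\<^sup>2 * p z) has_fps_expansion S\<^sup>2 * P"
    by (intro has_fps_expansion_mult has_fps_expansion_power expS expP)
  moreover have "\<forall>\<^sub>F z in nhds 0. (s z)\<^sup>2 * p z = 1"
    using eventually_nhds_in_open[OF open_ball, of 0 0 1] s2 by (auto elim!: eventually_mono)
  ultimately have "(\<lambda>z. 1) has_fps_expansion S\<^sup>2 * P"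
    using has_fps_expansion_cong by force
  then have SP: "S\<^sup>2 * P = 1"
    by (rule fps_expansion_unique_complex) simp
  define u v where "u = fps_nth S 1" and "v = fps_nth S 2"
  have "fps_nth (S\<^sup>2 * P) 1 = 0" "fps_nth (S\<^sup>2 * P) 2 = 0"
    unfolding SP by simp_all
  then have PQ: "2 * u + fps_nth P 1 = 0" "2 * v + u\<^sup>2 + 2 * u * fps_nth P 1 + fps_nth P 2 = 0"
    using S0 P0 by (simp_all add: u_def v_def fps_mult_nth numeral_2_eq_2 algebra_simps)
  then have P1: "fps_nth P 1 = - 2 * u"
    by (simp add: eq_neg_iff_add_eq_0 add.commute)
  have P2: "fps_nth P 2 = 3 * u\<^sup>2 - 2 * v"
    using PQ by algebra
  have r: "inv_log_coeff f 1 = u" "inv_log_coeff f 2 = (3 * u\<^sup>2 + 2 * v) / 2"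
    using inv_log_coeff_eq[OF f expP nz fp P0] unfolding P1 P2 by (simp_all add: field_simps)
  have "cmod (u\<^sup>2 + 2 * v) \<le> 1"
  proof -
    have inj': "inj_on (\<lambda>z. (s z)\<^sup>2 / z) (ball 0 1 - {0})"
    proof (rule inj_onI)
      fix z w assume zw: "z \<in> ball 0 1 - {0}" "w \<in> ball 0 1 - {0}" and "(s z)\<^sup>2 / z = (s w)\<^sup>2 / w"
      have "(s z)\<^sup>2 / z = 1 / f z" if "z \<in> ball 0 1 - {0}" for z
        using s2[of z] nz[of z] that by (simp add: fp field_simps)
      with zw \<open>(s z)\<^sup>2 / z = (s w)\<^sup>2 / w\<close> have "1 / f z = 1 / f w" by simp
      then have "f z = f w" by simp
      then show "z = w" using inj zw by (auto dest: inj_onD)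
    qed
    have "(\<lambda>z. (s z)\<^sup>2) holomorphic_on ball 0 1" "(\<lambda>z. (s z)\<^sup>2) has_fps_expansion S\<^sup>2"
      by (intro holomorphic_intros hols, intro has_fps_expansion_power expS)
    from area_theorem[OF this _ inj', of 2]
    have "(cmod (fps_nth (S\<^sup>2) 2))\<^sup>2 \<le> 1"
      by (simp add: S0 numeral_2_eq_2)
    moreover have "fps_nth (S\<^sup>2) 2 = u\<^sup>2 + 2 * v"
      using S0 by (simp add: u_def v_def power2_eq_square fps_mult_nth numeral_2_eq_2)
    ultimately show ?thesis by (simp add: abs_square_le_1)
  qed
  moreover have "(cmod u)\<^sup>2 + 3 * (cmod v)\<^sup>2 \<le> 1"
  proof -
    have sq: "z\<^sup>2 \<in> ball 0 1" if "z \<in> ball 0 1" for z :: complex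
      using that by (simp add: norm_power power_less_one_iff abs_square_less_1)
    have hol: "(s \<circ> (\<lambda>z. z\<^sup>2)) holomorphic_on ball 0 1"
      using sq by (intro holomorphic_on_compose_gen[OF _ hols] holomorphic_intros) auto
    have "(s \<circ> (\<lambda>z. z\<^sup>2)) has_fps_expansion fps_compose S (fps_X\<^sup>2)"
      by (intro has_fps_expansion_compose expS has_fps_expansion_fps_X_power) simp
    moreover have "inj_on (\<lambda>z. (s \<circ> (\<lambda>z. z\<^sup>2)) z / z) (ball 0 1 - {0})"
    proof (rule inj_onI)
      fix z w assume zw: "z \<in> ball 0 1 - {0}" "w \<in> ball 0 1 - {0}"
        and "(s \<circ> (\<lambda>z. z\<^sup>2)) z / z = (s \<circ> (\<lambda>z. z\<^sup>2)) w / w"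
      then have eq: "s (z\<^sup>2) / z = s (w\<^sup>2) / w" by simp
      have sqf: "(s (z\<^sup>2) / z)\<^sup>2 = 1 / f (z\<^sup>2)" if "z \<in> ball 0 1 - {0}" for z
        using s2[OF sq, of z] nz[OF sq, of z] that by (simp add: fp power_divide field_simps)
      have "1 / f (z\<^sup>2) = 1 / f (w\<^sup>2)"
        using sqf[OF zw(1)] sqf[OF zw(2)] eq by simp
      then have "f (z\<^sup>2) = f (w\<^sup>2)" by simp
      then have "z\<^sup>2 = w\<^sup>2"
        using inj_onD[OF inj] sq zw by blast
      moreover have "s (w\<^sup>2) \<noteq> 0"
        using s2[OF sq, of w] zw by auto
      ultimately show "z = w"
        using eq by simp
    qed
    moreover have nth: "fps_nth (fps_compose S (fps_X\<^sup>2)) 0 = 1"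
        "fps_nth (fps_compose S (fps_X\<^sup>2)) 2 = u" "fps_nth (fps_compose S (fps_X\<^sup>2)) 4 = v"
      using fps_compose_X_square_nth[of S 0] fps_compose_X_square_nth[of S 1] fps_compose_X_square_nth[of S 2]
      by (simp_all add: u_def v_def S0)
    ultimately have "(\<Sum>m<4. m * (cmod (fps_nth (fps_compose S (fps_X\<^sup>2)) (Suc m)))\<^sup>2) \<le> 1"
      by (intro area_theorem[OF hol])
    moreover have "(\<Sum>m<4. m * (cmod (fps_nth (fps_compose S (fps_X\<^sup>2)) (Suc m)))\<^sup>2) =
        (cmod u)\<^sup>2 + 2 * (cmod (fps_nth (fps_compose S (fps_X\<^sup>2)) 3))\<^sup>2 + 3 * (cmod v)\<^sup>2"
      unfolding nth(2,3)[symmetric] by (simp add: numeral_eq_Suc)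
    ultimately show ?thesis
      using zero_le_power2[of "cmod (fps_nth (fps_compose S (fps_X\<^sup>2)) 3)"] by linarith
  qed
  ultimately show ?thesis using that r by blast
qed

section \<open>The sharp estimates\<close>

lemma odd_slit_map_in_class_S: "(\<lambda>z. z / (1 - z\<^sup>2)) \<in> class_S"
proof -
  have nz: "1 - z\<^sup>2 \<noteq> 0" if "z \<in> ball 0 1" for z :: complex
  proof
    assume "1 - z\<^sup>2 = 0"
    then have "cmod z ^ 2 = 1"
      by (metis eq_iff_diff_eq_0 norm_one norm_power)
    moreover have "cmod z ^ 2 < 1"
      using that by (simp add: abs_square_less_1)
    ultimately show False by simp
  qed
  have "((\<lambda>z::complex. z / (1 - z\<^sup>2)) has_field_derivative 1) (at 0)"
    by (auto intro!: derivative_eq_intros)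
  moreover have "(\<lambda>z::complex. z / (1 - z\<^sup>2)) holomorphic_on ball 0 1"
    using nz by (intro holomorphic_intros) auto
  moreover have "inj_on (\<lambda>z::complex. z / (1 - z\<^sup>2)) (ball 0 1)"
  proof (rule inj_onI)
    fix z w :: complex assume zw: "z \<in> ball 0 1" "w \<in> ball 0 1" and "z / (1 - z\<^sup>2) = w / (1 - w\<^sup>2)"
    then have "z * (1 - w\<^sup>2) = w * (1 - z\<^sup>2)"
      using nz by (simp add: frac_eq_eq)
    then have "(z - w) * (1 + z * w) = 0"
      by algebra
    moreover have "1 + z * w \<noteq> 0"
    proof
      assume "1 + z * w = 0"
      then have "cmod (z * w) = 1"
        by (metis add_eq_0_iff norm_minus_cancel norm_one)
      moreover have "cmod z * cmod w < 1 * 1"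
        using zw by (intro mult_strict_mono') auto
      ultimately show False by (simp add: norm_mult)
    qed
    ultimately show "z = w" by simp
  qed
  ultimately show ?thesis
    by (simp add: class_S_def class_A_def DERIV_imp_deriv)
qed

theorem theorem2:
  shows "(\<forall>f\<in>class_S.
            - (sqrt 2 / 2) \<le> cmod (inv_log_coeff f 2) - cmod (inv_log_coeff f 1) \<and>
            cmod (inv_log_coeff f 2) - cmod (inv_log_coeff f 1) \<le> 1 / 2) \<and>
         (\<exists>f\<in>class_S. cmod (inv_log_coeff f 2) - cmod (inv_log_coeff f 1) = 1 / 2)"
proof (intro conjI ballI)
  fix f assume "f \<in> class_S"
  then obtain u v where coeff: "inv_log_coeff f 1 = u" "inv_log_coeff f 2 = (3 * u\<^sup>2 + 2 * v) / 2"
    and uv: "cmod (u\<^sup>2 + 2 * v) \<le> 1" "(cmod u)\<^sup>2 + 3 * (cmod v)\<^sup>2 \<le> 1"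
    by (rule class_S_inv_log_coeffs)
  have \<Gamma>2: "cmod (inv_log_coeff f 2) = cmod (3 * u\<^sup>2 + 2 * v) / 2"
    unfolding coeff by (simp add: norm_divide)
  have "(cmod u)\<^sup>2 \<le> 1"
    using uv(2) zero_le_power2[of "cmod v"] by linarith
  then have u1: "cmod u \<le> 1"
    by (simp add: abs_square_le_1)
  have "cmod (3 * u\<^sup>2 + 2 * v) \<le> cmod (u\<^sup>2 + 2 * v) + cmod (2 * u\<^sup>2)"
    using norm_triangle_ineq[of "u\<^sup>2 + 2 * v" "2 * u\<^sup>2"] by (simp add: algebra_simps)
  also have "\<dots> \<le> 1 + 2 * cmod u"
    using uv(1) u1 by (intro add_mono) (auto simp: norm_mult norm_power power2_eq_square mult_left_le)
  finally show "cmod (inv_log_coeff f 2) - cmod (inv_log_coeff f 1) \<le> 1 / 2"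
    unfolding \<Gamma>2 coeff(1) by simp
  show "- (sqrt 2 / 2) \<le> cmod (inv_log_coeff f 2) - cmod (inv_log_coeff f 1)"
  proof (cases "cmod u \<le> sqrt 2 / 2")
    case True
    then show ?thesis unfolding coeff(1) by (smt (verit) norm_ge_zero)
  next
    case False
    (* The map t \<mapsto> 3/2 t^2 - t is increasing for t > 1/3, so its value at |u| exceeds that at k. *)
    define k where "k = sqrt 2 / 2"
    have "1 \<le> sqrt 2" by simp
    then have k: "k > 1/3" "k\<^sup>2 = 1/2" "cmod u > k"
      using False unfolding k_def by (linarith, simp add: power_divide, simp)
    have "(cmod u)\<^sup>2 > 1/2"
      using k power_strict_mono[of k "cmod u" 2] by simp
    then have "(cmod v)\<^sup>2 \<le> (1/2)\<^sup>2"
      using uv(2) by (simp add: power_divide)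
    then have v: "cmod v \<le> 1/2"
      by (rule power2_le_imp_le) simp
    have "0 \<le> (cmod u - k) * (3 / 2 * (cmod u + k) - 1)"
      using k by (intro mult_nonneg_nonneg) auto
    then have "3 / 2 * (cmod u)\<^sup>2 - cmod u \<ge> 3 / 4 - k"
    proof -
      have "(cmod u - k) * (3 / 2 * (cmod u + k) - 1) = 3 / 2 * (cmod u)\<^sup>2 - cmod u - 3 / 2 * k\<^sup>2 + k"
        by algebra
      with \<open>0 \<le> (cmod u - k) * (3 / 2 * (cmod u + k) - 1)\<close> k(2) show ?thesis by simp
    qed
    moreover have "cmod (3 * u\<^sup>2 + 2 * v) \<ge> 3 * (cmod u)\<^sup>2 - 2 * cmod v"
      using norm_diff_ineq[of "3 * u\<^sup>2" "2 * v"] by (simp add: norm_mult norm_power)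
    ultimately show ?thesis
      using v unfolding \<Gamma>2 coeff(1) k_def by linarith
  qed
next
  let ?p = "\<lambda>z::complex. 1 / (1 - z\<^sup>2)"
  let ?f = "\<lambda>z::complex. z / (1 - z\<^sup>2)"
  let ?P = "inverse (1 - fps_X\<^sup>2 :: complex fps)"
  have "(\<lambda>z::complex. inverse (1 - z\<^sup>2)) has_fps_expansion ?P"
    by (intro has_fps_expansion_inverse has_fps_expansion_diff has_fps_expansion_1 has_fps_expansion_fps_X_power) simp
  then have expP: "?p has_fps_expansion ?P"
    by (simp add: inverse_eq_divide)
  have "?P * (1 - fps_X\<^sup>2) = 1"
    by (rule inverse_mult_eq_1) simp
  then have "fps_nth (?P * (1 - fps_X\<^sup>2)) 1 = 0" "fps_nth (?P * (1 - fps_X\<^sup>2)) 2 = 0"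
    by simp_all
  moreover have P0: "fps_nth ?P 0 = 1"
    by simp
  ultimately have P: "fps_nth ?P 1 = 0" "fps_nth ?P 2 = 1"
    by (simp_all add: right_diff_distrib fps_X_power_mult_right_nth)
  have "?p z \<noteq> 0" if "z \<in> ball 0 1" for z
  proof -
    have "cmod (z\<^sup>2) < 1"
      using that by (simp add: norm_power abs_square_less_1)
    then show ?thesis by auto
  qed
  from inv_log_coeff_eq[OF odd_slit_map_in_class_S expP this _ P0]
  have "inv_log_coeff ?f 1 = 0" "inv_log_coeff ?f 2 = - 1 / 2"
    unfolding P by simp_all
  then have "cmod (inv_log_coeff ?f 2) - cmod (inv_log_coeff ?f 1) = 1 / 2"
    by (simp add: norm_divide)
  with odd_slit_map_in_class_S show "\<exists>f\<in>class_S. cmod (inv_log_coeff f 2) - cmod (inv_log_coeff f 1) = 1 / 2"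
    by blast
qed

end
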